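(* Let $I\times J=[a,b]\times[c,d]\subset\mathbb{R}^2$, let $M,N\in\mathbb{N}\cup\{0\}$ and let $P:I\times J\to\mathbb{R}$ be an integrable function. Suppose that $$\int_a^b\int_c^d P(y,z)\frac{(b-y)^i}{i!}\frac{(d-z)^j}{j!}\,dz\,dy=0,\quad i\in\{0,\ldots,M\},\ j\in\{0,\ldots,N\};$$ $$\int_a^s\int_c^d P(y,z)\frac{(s-y)^M}{M!}\frac{(d-z)^j}{j!}\,dz\,dy=0,\quad j\in\{0,\ldots,N\},\ \forall s\in[a,b];$$ $$\int_a^b\int_c^t P(y,z)\frac{(b-y)^i}{i!}\frac{(t-z)^N}{N!}\,dz\,dy=0,\quad i\in\{0,\ldots,M\},\ \forall t\in[c,d];$$ $$\int_a^s\int_c^t P(y,z)\frac{(s-y)^M}{M!}\frac{(t-z)^N}{N!}\,dz\,dy\ge 0,\quad \forall s\in[a,b],\ \forall t\in[c,d].$$ Then $$\Lambda(f)=\int_a^b\int_c^d P(y,z)f(y,z)\,dz\,dy\ge 0$$ for every function $f:I\times J\to\mathbb{R}$ that has continuous partial derivatives $f_{(i,j)}$ for $i\in\{0,\ldots,M+1\}$, $j\in\{0,\ldots,N+1\}$ and is completely monotonic of order $(M+1,N+1)$ on $I\times J$.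
   Context: $f_{(i,j)}=\dfrac{\partial^{i+j}f}{\partial y^i\partial z^j}$, with $f_{(0,0)}=f$; $(\cdot)^0=1$. A function $f:I\times J\to\mathbb{R}$ is completely monotonic of order $(m,n)$ if its partial derivatives $f_{(i,j)}$ exist and satisfy $(-1)^{i+j}f_{(i,j)}(y,z)\ge 0$ on $I\times J$ for all $i\in\{0,1,\ldots,m\}$, $j\in\{0,1,\ldots,n\}$. *)

theory Defs
  imports "HOL-Analysis.Analysis"
begin

text \<open>
  Functions on \<open>I \<times> J\<close> are modelled by total functions on \<^typ>\<open>real \<times> real\<close>. All derivatives are
  taken relative to \<open>I\<close> or \<open>J\<close>, so they are one-sided at endpoints, and the values outside
  \<open>I \<times> J\<close> never matter. The derivative relative to an interval is unique as soon as the interval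
  is nondegenerate.
\<close>

definition d_y :: "real set \<Rightarrow> (real \<times> real \<Rightarrow> real) \<Rightarrow> real \<times> real \<Rightarrow> real" where
  "d_y I f = (\<lambda>(y, z). vector_derivative (\<lambda>u. f (u, z)) (at y within I))"

definition d_z :: "real set \<Rightarrow> (real \<times> real \<Rightarrow> real) \<Rightarrow> real \<times> real \<Rightarrow> real" where
  "d_z J f = (\<lambda>(y, z). vector_derivative (\<lambda>v. f (y, v)) (at z within J))"

text \<open>
  \<open>f\<^bsub>(i,j)\<^esub> = \<partial>\<^sup>i/\<partial>y\<^sup>i (\<partial>\<^sup>j/\<partial>z\<^sup>j f)\<close>: differentiate \<open>j\<close> times in \<open>z\<close>, then \<open>i\<close> times in \<open>y\<close>.
\<close>

definition partial_deriv ::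
  "real set \<Rightarrow> real set \<Rightarrow> (real \<times> real \<Rightarrow> real) \<Rightarrow> nat \<Rightarrow> nat \<Rightarrow> real \<times> real \<Rightarrow> real" where
  "partial_deriv I J f i j = (d_y I ^^ i) ((d_z J ^^ j) f)"

text \<open>
  The operators above are total, so existence of \<open>f\<^bsub>(i,j)\<^esub>\<close> on \<open>I \<times> J\<close> is stated separately:
  every differentiation on the way from \<open>f\<close> to \<open>f\<^bsub>(i,j)\<^esub>\<close> is legitimate on all of \<open>I \<times> J\<close>.
\<close>

definition partial_deriv_exists ::
  "real set \<Rightarrow> real set \<Rightarrow> (real \<times> real \<Rightarrow> real) \<Rightarrow> nat \<Rightarrow> nat \<Rightarrow> bool" where
  "partial_deriv_exists I J f i j \<longleftrightarrow>
     (\<forall>l<j. \<forall>y\<in>I. \<forall>z\<in>J.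
        (\<lambda>v. partial_deriv I J f 0 l (y, v)) differentiable (at z within J)) \<and>
     (\<forall>k<i. \<forall>y\<in>I. \<forall>z\<in>J.
        (\<lambda>u. partial_deriv I J f k j (u, z)) differentiable (at y within I))"

definition continuous_partial_derivs ::
  "real set \<Rightarrow> real set \<Rightarrow> nat \<Rightarrow> nat \<Rightarrow> (real \<times> real \<Rightarrow> real) \<Rightarrow> bool" where
  "continuous_partial_derivs I J m n f \<longleftrightarrow>
     (\<forall>i\<in>{0..m}. \<forall>j\<in>{0..n}.
        partial_deriv_exists I J f i j \<and> continuous_on (I \<times> J) (partial_deriv I J f i j))"

definition completely_monotonic ::
  "real set \<Rightarrow> real set \<Rightarrow> nat \<Rightarrow> nat \<Rightarrow> (real \<times> real \<Rightarrow> real) \<Rightarrow> bool" where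
  "completely_monotonic I J m n f \<longleftrightarrow>
     (\<forall>i\<in>{0..m}. \<forall>j\<in>{0..n}.
        partial_deriv_exists I J f i j \<and>
        (\<forall>y\<in>I. \<forall>z\<in>J. (-1) ^ (i + j) * partial_deriv I J f i j (y, z) \<ge> 0))"

end

theory Submission
  imports Defs
begin

text \<open>
  Expand \<open>f\<close> in \<open>z\<close> about \<open>d\<close> by Taylor's formula with integral remainder, and then every resulting
  coefficient in \<open>y\<close> about \<open>b\<close>. Because the expansion points are the right endpoints, the terms are
  polynomials in \<open>b - y\<close> and \<open>d - z\<close>, and the remainders are integrals over \<open>s\<close> and \<open>t\<close> against the
  truncated powers \<open>(s - y)\<^sub>+\<^sup>M / M!\<close> and \<open>(t - z)\<^sub>+\<^sup>N / N!\<close>. Interchanging these integrals with \<open>\<Lambda>\<close>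
  turns the hypotheses into: all terms vanish except the double remainder
  \<open>\<integral>\<integral> (-1)\<^bsup>M+N+2\<^esup> f\<^bsub>(M+1,N+1)\<^esub>(s, t) \<Lambda>((s - y)\<^sub>+\<^sup>M / M! * (t - z)\<^sub>+\<^sup>N / N!) ds dt\<close>,
  whose integrand is nonnegative.
\<close>

section \<open>Truncated powers and Taylor's formula at a right endpoint\<close>

text \<open>The cutoff is non-strict so that for \<open>n = 0\<close> the function is exactly the
  indicator of \<open>y \<le> s\<close>. This lets integrals over the closed interval
  \<open>{a..s}\<close> be rewritten pointwise as integrals over \<open>{a..b}\<close>.\<close>

definition trunc_pow :: "nat \<Rightarrow> real \<Rightarrow> real \<Rightarrow> real" where
  "trunc_pow n s y = (if y \<le> s then (s - y) ^ n / fact n else 0)"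

lemma trunc_pow_nonneg: "0 \<le> trunc_pow n s y"
  by (simp add: trunc_pow_def)

lemma trunc_pow_le:
  assumes "s \<in> {a..b}" "y \<in> {a..b}"
  shows "trunc_pow n s y \<le> (b - a) ^ n / fact n"
proof -
  have "(s - y) ^ n \<le> (b - a) ^ n" if "y \<le> s"
    using assms that by (intro power_mono) auto
  then show ?thesis
    using assms by (auto simp: trunc_pow_def divide_right_mono)
qed

lemma measurable_trunc_pow [measurable (raw)]:
  assumes [measurable]: "f \<in> borel_measurable M" "g \<in> borel_measurable M"
  shows "(\<lambda>x. trunc_pow n (f x) (g x)) \<in> borel_measurable M"
  unfolding trunc_pow_def by measurable

text \<open>The Taylor polynomial is differentiated in its expansion point \<open>s\<close>, with
  \<open>y\<close> fixed. By the product rule each summand contributes two terms, and one of them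
  cancels against the previous summand, so the sum telescopes to its top term.\<close>

lemma taylor_sum_has_vector_derivative:
  fixes D :: "nat \<Rightarrow> real \<Rightarrow> real"
  assumes "\<And>i. i \<le> n \<Longrightarrow> (D i has_vector_derivative D (Suc i) s) (at s within S)"
  shows "((\<lambda>s. \<Sum>i\<le>n. (-1) ^ i * D i s * ((s - y) ^ i / fact i)) has_vector_derivative
           (-1) ^ n * D (Suc n) s * ((s - y) ^ n / fact n)) (at s within S)"
  using assms
proof (induction n)
  case 0
  then show ?case by simp
next
  case (Suc n)
  have pow: "((\<lambda>s. (s - y) ^ Suc n / fact (Suc n)) has_field_derivative (s - y) ^ n / fact n)
      (at s within S)"
    by (rule derivative_eq_intros refl | simp)+
  have D: "(D (Suc n) has_field_derivative D (Suc (Suc n)) s) (at s within S)"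
    using Suc.prems[of "Suc n"] by (simp add: has_real_derivative_iff_has_vector_derivative)
  have "((\<lambda>s. (-1) ^ Suc n * D (Suc n) s * ((s - y) ^ Suc n / fact (Suc n))) has_field_derivative
      (-1) ^ Suc n * D (Suc (Suc n)) s * ((s - y) ^ Suc n / fact (Suc n)) +
      (-1) ^ Suc n * D (Suc n) s * ((s - y) ^ n / fact n)) (at s within S)"
    by (rule DERIV_cong[OF DERIV_mult[OF DERIV_cmult[OF D] pow]]) (simp add: mult.commute)
  from has_vector_derivative_add[OF Suc.IH this[unfolded has_real_derivative_iff_has_vector_derivative]]
  show ?case
    using Suc.prems by simp
qed

text \<open>Integrate the telescoped derivative over \<open>{y..b}\<close>. The truncated power then
  spreads the remainder over the fixed interval \<open>{a..b}\<close>: the domain of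
  \<open>s\<close> no longer depends on \<open>y\<close>, which prepares the exchange of
  integrals.\<close>

lemma taylor_right_endpoint:
  fixes D :: "nat \<Rightarrow> real \<Rightarrow> real"
  assumes deriv: "\<And>i s. i \<le> n \<Longrightarrow> s \<in> {a..b} \<Longrightarrow>
      (D i has_vector_derivative D (Suc i) s) (at s within {a..b})"
    and cont: "continuous_on {a..b} (D (Suc n))"
    and y: "y \<in> {a..b}"
  shows "D 0 y = (\<Sum>i\<le>n. (-1) ^ i * D i b * ((b - y) ^ i / fact i)) +
    (-1) ^ Suc n * (LINT s|lborel. indicator {a..b} s * (D (Suc n) s * trunc_pow n s y))"
proof -
  let ?T = "\<lambda>s. \<Sum>i\<le>n. (-1) ^ i * D i s * ((s - y) ^ i / fact i)"
  let ?r = "\<lambda>s. (-1) ^ n * D (Suc n) s * ((s - y) ^ n / fact n)"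
  have "(?r has_integral ?T b - ?T y) {y..b}"
  proof (rule fundamental_theorem_of_calculus)
    show "y \<le> b" using y by simp
    fix s assume "s \<in> {y..b}"
    then have "(?T has_vector_derivative ?r s) (at s within {a..b})"
      using y by (intro taylor_sum_has_vector_derivative deriv) auto
    then show "(?T has_vector_derivative ?r s) (at s within {y..b})"
      by (rule has_vector_derivative_within_subset) (use y in auto)
  qed
  \<comment> \<open>At \<open>s = y\<close> all powers with \<open>i > 0\<close> vanish and
    \<open>0 ^ 0 = 1\<close> leaves the first summand.\<close>
  moreover have "?T y = D 0 y"
    by (subst sum.atMost_shift) simp
  moreover have "set_integrable lborel {y..b} ?r"
    using y by (intro borel_integrable_atLeastAtMost' continuous_intros continuous_on_subset[OF cont]) auto
  then have "(LINT s:{y..b}|lborel. ?r s) = integral {y..b} ?r"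
    by (rule set_borel_integral_eq_integral)
  moreover have "(LINT s:{y..b}|lborel. ?r s) =
      (LINT s|lborel. (-1) ^ n * (indicator {a..b} s * (D (Suc n) s * trunc_pow n s y)))"
    unfolding set_lebesgue_integral_def using y
    by (intro Bochner_Integration.integral_cong) (auto simp: trunc_pow_def indicator_def)
  ultimately have "?T b - D 0 y =
      (-1) ^ n * (LINT s|lborel. indicator {a..b} s * (D (Suc n) s * trunc_pow n s y))"
    by (simp only: integral_unique integral_mult_right_zero)
  then show ?thesis by simp
qed

section \<open>Iterated gauge integrals as Lebesgue integrals over the plane\<close>

text \<open>
  Only the Borel version \<open>g\<close> needs to be integrable: sections of \<open>F\<close> may fail to be integrable on a
  null set, where the inner integral has the junk value \<open>0\<close>.
\<close>

lemma iterated_integral_eq_lborel: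
  fixes F g :: "real \<times> real \<Rightarrow> real"
  assumes g: "integrable lborel g"
    and ae: "AE p in lborel. indicator (A \<times> B) p * F p = g p"
  shows "integral A (\<lambda>y. integral B (\<lambda>z. F (y, z))) = (LINT p|lborel. g p)"
proof -
  have g': "integrable (lborel \<Otimes>\<^sub>M lborel) (\<lambda>(y, z). g (y, z))"
    using g by (simp add: lborel_prod)
  have "AE p in lborel \<Otimes>\<^sub>M lborel. indicator (A \<times> B) p * F p = g p"
    unfolding lborel_prod by (rule ae)
  from lborel_pair.AE_pair[OF this] lborel_pair.AE_integrable_fst[OF g']
  \<comment> \<open>For almost every \<open>y\<close> the section of \<open>g\<close> is integrable
    and agrees almost everywhere with the cut-off section of \<open>F\<close>. If \<open>y\<close>
    lies outside \<open>A\<close>, that section is zero almost everywhere, so both sides are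
    0.\<close>
  have "AE y in lborel. indicator A y * integral B (\<lambda>z. F (y, z)) = (LINT z|lborel. g (y, z))"
  proof eventually_elim
    case (elim y)
    have "((\<lambda>z. g (y, z)) has_integral (LINT z|lborel. g (y, z))) UNIV"
      by (rule has_integral_integral_lborel) (use elim in simp)
    moreover from elim(1) have "AE z in lborel. g (y, z) = indicator A y * (if z \<in> B then F (y, z) else 0)"
      by eventually_elim (auto simp: indicator_def split: if_splits)
    ultimately have "((\<lambda>z. indicator A y * (if z \<in> B then F (y, z) else 0))
        has_integral (LINT z|lborel. g (y, z))) UNIV"
      by (subst (asm) has_integral_AE) auto
    then have "integral UNIV (\<lambda>z. indicator A y * (if z \<in> B then F (y, z) else 0)) =
        (LINT z|lborel. g (y, z))"
      by (rule integral_unique)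
    then show ?case
      by (simp add: integral_restrict_UNIV)
  qed
  then have eq: "AE y in lborel. (LINT z|lborel. g (y, z)) = (if y \<in> A then integral B (\<lambda>z. F (y, z)) else 0)"
    by eventually_elim (auto simp: indicator_def split: if_splits)
  have "((\<lambda>y. LINT z|lborel. g (y, z)) has_integral (LINT y|lborel. LINT z|lborel. g (y, z))) UNIV"
    by (rule has_integral_integral_lborel, rule lborel_pair.integrable_fst[OF g', simplified])
  then have "((\<lambda>y. if y \<in> A then integral B (\<lambda>z. F (y, z)) else 0)
      has_integral (LINT y|lborel. LINT z|lborel. g (y, z))) UNIV"
    by (subst (asm) has_integral_AE) (use eq in auto)
  then have "integral A (\<lambda>y. integral B (\<lambda>z. F (y, z))) = (LINT y|lborel. LINT z|lborel. g (y, z))"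
    by (simp add: has_integral_restrict_UNIV integral_unique)
  also have "\<dots> = (LINT p|lborel. g p)"
    using lborel_pair.integral_fst[OF g'] by (simp add: lborel_prod)
  finally show ?thesis .
qed

section \<open>Bounded weights and the interchange of integrals\<close>

text \<open>The bound is asked for only where \<open>Q\<close> is nonzero because the weights used
  later are controlled only on a compact set carrying \<open>Q\<close>.\<close>

lemma integrable_mult_bounded:
  fixes Q w :: "'a \<Rightarrow> real"
  assumes Q: "integrable M Q" and w[measurable]: "w \<in> borel_measurable M"
    and B: "\<And>x. Q x \<noteq> 0 \<Longrightarrow> \<bar>w x\<bar> \<le> B"
  shows "integrable M (\<lambda>x. Q x * w x)"
proof (rule Bochner_Integration.integrable_bound)
  show "integrable M (\<lambda>x. B * Q x)" using Q by simp
  have [measurable]: "Q \<in> borel_measurable M" using Q by simp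
  show "(\<lambda>x. Q x * w x) \<in> borel_measurable M" by measurable
  show "AE x in M. norm (Q x * w x) \<le> norm (B * Q x)"
  proof (rule AE_I2)
    fix x
    show "norm (Q x * w x) \<le> norm (B * Q x)"
    proof (cases "Q x = 0")
      case False
      then have "\<bar>w x\<bar> \<le> \<bar>B\<bar>" using B[of x] by linarith
      then have "\<bar>Q x\<bar> * \<bar>w x\<bar> \<le> \<bar>Q x\<bar> * \<bar>B\<bar>" by (intro mult_left_mono) auto
      then show ?thesis by (simp add: abs_mult mult.commute)
    qed simp
  qed
qed

text \<open>Fubini applies because the integrand is dominated by \<open>B\<close> times
  \<open>indicator {a..b} s * \<bar>Q p\<bar>\<close>, which is integrable on the product since
  \<open>{a..b}\<close> has finite measure. The integrability claim is recorded too, so that a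
  Taylor expansion can be integrated term by term.\<close>

lemma integral_mult_interchange:
  fixes Q :: "'a::euclidean_space \<Rightarrow> real" and H :: "real \<Rightarrow> 'a \<Rightarrow> real"
  assumes Q: "integrable lborel Q"
    and H: "(\<lambda>(s, p). H s p) \<in> borel_measurable (lborel \<Otimes>\<^sub>M lborel)"
    and B: "\<And>s p. \<bar>H s p\<bar> \<le> B"
  shows "integrable lborel (\<lambda>p. Q p * (LINT s|lborel. indicator {a..b} s * H s p))" (is ?int)
    and "(LINT p|lborel. Q p * (LINT s|lborel. indicator {a..b} s * H s p)) =
      (LINT s|lborel. indicator {a..b} s * (LINT p|lborel. Q p * H s p))" (is ?eq)
proof -
  have [measurable]: "Q \<in> borel_measurable borel"
    using Q by (simp add: integrable_iff_bounded)
  note H[measurable]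
  have R: "integrable (lborel \<Otimes>\<^sub>M lborel) (\<lambda>(s, p). indicator {a..b} s * Q p)"
  proof (rule lborel_pair.Fubini_integrable)
    show "integrable lborel (\<lambda>s. LINT p|lborel. norm (case (s, p) of (s, p) \<Rightarrow> indicator {a..b} s * Q p))"
      by (simp add: abs_mult integrable_real_indicator emeasure_lborel_Icc_eq)
    show "AE s in lborel. integrable lborel (\<lambda>p. case (s, p) of (s, p) \<Rightarrow> indicator {a..b} s * Q p)"
      using Q by simp
  qed measurable
  then have "integrable (lborel \<Otimes>\<^sub>M lborel) (\<lambda>x. (case x of (s, p) \<Rightarrow> indicator {a..b} s * Q p) *
      (case x of (s, p) \<Rightarrow> H s p))"
    by (rule integrable_mult_bounded) (use H B in auto)
  then have int: "integrable (lborel \<Otimes>\<^sub>M lborel) (\<lambda>(s, p). indicator {a..b} s * Q p * H s p)"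
    by (simp add: case_prod_beta')
  have 1: "(LINT s|lborel. indicator {a..b} s * Q p * H s p) =
      Q p * (LINT s|lborel. indicator {a..b} s * H s p)" for p
    by (simp add: ac_simps flip: integral_mult_right_zero)
  have 2: "(LINT p|lborel. indicator {a..b} s * Q p * H s p) =
      indicator {a..b} s * (LINT p|lborel. Q p * H s p)" for s
    by (simp add: ac_simps flip: integral_mult_right_zero)
  show ?int using lborel_pair.integrable_snd[OF int] by (simp add: 1)
  show ?eq using lborel_pair.Fubini_integral[OF int] by (simp add: 1 2)
qed

lemma bounded_on_compact:
  fixes f :: "'a::topological_space \<Rightarrow> real"
  assumes "compact K" "continuous_on K f"
  obtains B where "\<And>x. x \<in> K \<Longrightarrow> \<bar>f x\<bar> \<le> B"
proof -
  have "bounded (f ` K)"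
    using assms by (intro compact_imp_bounded compact_continuous_image)
  then show ?thesis
    using that by (auto simp: bounded_iff)
qed

section \<open>Taylor expansion inside an integral functional\<close>

text \<open>
  The integrand is a Taylor expansion in the variable that \<open>\<phi>\<close> extracts from \<open>p\<close>; the \<open>p\<close> argument of
  \<open>D i\<close> carries the other variable as a parameter.
\<close>

lemma functional_taylor:
  fixes Q :: "'a::euclidean_space \<Rightarrow> real" and \<phi> :: "'a \<Rightarrow> real"
    and D :: "nat \<Rightarrow> real \<Rightarrow> 'a \<Rightarrow> real"
  assumes Q: "integrable lborel Q" and K: "compact K" and QK: "\<And>p. p \<notin> K \<Longrightarrow> Q p = 0"
    and \<phi>: "continuous_on K \<phi>" "\<And>p. p \<in> K \<Longrightarrow> \<phi> p \<in> {a..b}"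
    and deriv: "\<And>i s p. i \<le> n \<Longrightarrow> s \<in> {a..b} \<Longrightarrow> p \<in> K \<Longrightarrow>
      ((\<lambda>s. D i s p) has_vector_derivative D (Suc i) s p) (at s within {a..b})"
    and cont: "\<And>i. i \<le> Suc n \<Longrightarrow> continuous_on ({a..b} \<times> K) (\<lambda>(s, p). D i s p)"
  shows "(LINT p|lborel. Q p * D 0 (\<phi> p) p) =
    (\<Sum>i\<le>n. (-1) ^ i * (LINT p|lborel. Q p * D i b p * trunc_pow i b (\<phi> p))) +
    (-1) ^ Suc n * (LINT s|lborel. indicator {a..b} s *
      (LINT p|lborel. Q p * D (Suc n) s p * trunc_pow n s (\<phi> p)))"
proof (cases "K = {}")
  case True
  then show ?thesis using QK by simp
next
  case False
  then have ab: "a \<le> b" using \<phi>(2) by force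
  \<comment> \<open>The cutoffs make \<open>?H\<close> measurable and bounded on the whole space,
    whereas \<open>D\<close> and \<open>\<phi>\<close> are controlled only for \<open>s\<close> in
    \<open>{a..b}\<close> and \<open>p\<close> in \<open>K\<close>. They change no integral below:
    \<open>Q\<close> vanishes off \<open>K\<close>, and the integral over \<open>s\<close> has its
    own indicator.\<close>
  let ?H = "\<lambda>s p. indicator ({a..b} \<times> K) (s, p) * D (Suc n) s p *
    trunc_pow n s (indicator K p * \<phi> p)"
  have [measurable]: "K \<in> sets borel" using K by (simp add: borel_compact)
  have \<phi>_meas [measurable]: "(\<lambda>p. indicator K p * \<phi> p) \<in> borel_measurable borel"
    using borel_measurable_continuous_on_indicator[OF _ \<phi>(1)] by simp
  have D_meas: "(\<lambda>x. indicator ({a..b} \<times> K) x * (case x of (s, p) \<Rightarrow> D i s p))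
      \<in> borel_measurable (borel \<Otimes>\<^sub>M borel)" if "i \<le> Suc n" for i
    using borel_measurable_continuous_on_indicator[OF _ cont[OF that]] K
    by (simp add: borel_prod borel_compact compact_Times)
  \<comment> \<open>In polynomial form the weight is continuous on the compact set \<open>K\<close>,
    hence bounded there.\<close>
  have term_int: "integrable lborel (\<lambda>p. Q p * D i b p * ((b - \<phi> p) ^ i / fact i))" if i: "i \<le> n" for i
  proof -
    have "continuous_on K (\<lambda>p. (b, p))" by (intro continuous_intros)
    from continuous_on_compose2[OF cont[of i] this]
    have "continuous_on K (D i b)" using i ab by (simp add: image_subset_iff)
    then have c: "continuous_on K (\<lambda>p. D i b p * ((b - \<phi> p) ^ i / fact i))"
      by (intro continuous_intros \<phi>(1)) auto
    obtain B where B: "\<And>p. p \<in> K \<Longrightarrow> \<bar>D i b p * ((b - \<phi> p) ^ i / fact i)\<bar> \<le> B"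
      using bounded_on_compact[OF K c] by blast
    have "integrable lborel (\<lambda>p. Q p * (indicator K p * (D i b p * ((b - \<phi> p) ^ i / fact i))))"
    proof (rule integrable_mult_bounded[OF Q])
      show "(\<lambda>p. indicator K p * (D i b p * ((b - \<phi> p) ^ i / fact i))) \<in> borel_measurable lborel"
        using borel_measurable_continuous_on_indicator[OF _ c] by simp
      show "\<bar>indicator K p * (D i b p * ((b - \<phi> p) ^ i / fact i))\<bar> \<le> B" if "Q p \<noteq> 0" for p
        using B[of p] QK[of p] that by (auto simp: indicator_def)
    qed
    moreover have "Q p * (indicator K p * x) = Q p * x" for p x
      using QK[of p] by (auto simp: indicator_def)
    ultimately show ?thesis by (simp add: mult.assoc)
  qed
  have H_meas: "(\<lambda>(s, p). ?H s p) \<in> borel_measurable (lborel \<Otimes>\<^sub>M lborel)"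
  proof -
    have [measurable]: "(\<lambda>x. indicator ({a..b} \<times> K) x * (case x of (s, p) \<Rightarrow> D (Suc n) s p))
        \<in> borel_measurable (borel \<Otimes>\<^sub>M borel)"
      by (rule D_meas) simp
    have "(\<lambda>x. (indicator ({a..b} \<times> K) x * (case x of (s, p) \<Rightarrow> D (Suc n) s p)) *
        trunc_pow n (fst x) (indicator K (snd x) * \<phi> (snd x)))
        \<in> borel_measurable (borel \<Otimes>\<^sub>M borel)"
      by measurable
    then show ?thesis by (simp add: case_prod_beta' cong: measurable_cong_sets)
  qed
  obtain B where "\<And>x. x \<in> {a..b} \<times> K \<Longrightarrow> \<bar>case x of (s, p) \<Rightarrow> D (Suc n) s p\<bar> \<le> B"
    using bounded_on_compact[OF compact_Times[OF compact_Icc K] cont[of "Suc n"]] by blast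
  then have B: "\<bar>D (Suc n) s p\<bar> \<le> B" if "s \<in> {a..b}" "p \<in> K" for s p
    using that by force
  have H_bd: "\<bar>?H s p\<bar> \<le> \<bar>B\<bar> * ((b - a) ^ n / fact n)" for s p
  proof (cases "s \<in> {a..b} \<and> p \<in> K")
    case True
    then have "\<bar>D (Suc n) s p\<bar> * trunc_pow n s (\<phi> p) \<le> \<bar>B\<bar> * ((b - a) ^ n / fact n)"
      using B[of s p] \<phi>(2)[of p]
      by (intro mult_mono trunc_pow_le) (auto simp: trunc_pow_nonneg)
    then show ?thesis using True by (simp add: abs_mult trunc_pow_nonneg)
  next
    case False
    then show ?thesis using ab by (auto simp: indicator_def)
  qed
  note swap = integral_mult_interchange[OF Q H_meas H_bd, of a b]
  have pt: "Q p * D 0 (\<phi> p) p =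
      (\<Sum>i\<le>n. (-1) ^ i * (Q p * D i b p * ((b - \<phi> p) ^ i / fact i))) +
      (-1) ^ Suc n * (Q p * (LINT s|lborel. indicator {a..b} s * ?H s p))" for p
  proof (cases "p \<in> K")
    case True
    have "D 0 (\<phi> p) p = (\<Sum>i\<le>n. (-1) ^ i * D i b p * ((b - \<phi> p) ^ i / fact i)) +
       (-1) ^ Suc n * (LINT s|lborel. indicator {a..b} s * (D (Suc n) s p * trunc_pow n s (\<phi> p)))"
    proof (rule taylor_right_endpoint[where D = "\<lambda>i s. D i s p"])
      show "continuous_on {a..b} (\<lambda>s. D (Suc n) s p)"
      proof -
        have "continuous_on {a..b} (\<lambda>s. (s, p))" by (intro continuous_intros)
        from continuous_on_compose2[OF cont[of "Suc n"] this] show ?thesis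
          using True by (simp add: image_subset_iff)
      qed
    qed (use deriv \<phi>(2) True in auto)
    moreover have "(LINT s|lborel. indicator {a..b} s * (D (Suc n) s p * trunc_pow n s (\<phi> p))) =
        (LINT s|lborel. indicator {a..b} s * ?H s p)"
      using True by (intro Bochner_Integration.integral_cong) (auto simp: indicator_def)
    ultimately show ?thesis
      by (simp only: distrib_left sum_distrib_left ac_simps)
  qed (simp add: QK)
  have sum_int: "integrable lborel
      (\<lambda>p. \<Sum>i\<le>n. (-1) ^ i * (Q p * D i b p * ((b - \<phi> p) ^ i / fact i)))"
    by (intro Bochner_Integration.integrable_sum integrable_mult_right term_int) simp
  \<comment> \<open>On \<open>K\<close> one has \<open>\<phi> p \<le> b\<close>, so the cutoff at
    \<open>b\<close> is inactive; off \<open>K\<close> both sides are 0.\<close>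
  have trunc: "Q p * D i b p * ((b - \<phi> p) ^ i / fact i) = Q p * D i b p * trunc_pow i b (\<phi> p)" for i p
    using QK[of p] \<phi>(2)[of p] by (cases "p \<in> K") (auto simp: trunc_pow_def)
  have "(LINT p|lborel. Q p * D 0 (\<phi> p) p) =
    (LINT p|lborel. (\<Sum>i\<le>n. (-1) ^ i * (Q p * D i b p * ((b - \<phi> p) ^ i / fact i)))) +
    (-1) ^ Suc n * (LINT p|lborel. Q p * (LINT s|lborel. indicator {a..b} s * ?H s p))"
    unfolding pt Bochner_Integration.integral_add[OF sum_int integrable_mult_right[OF swap(1)]]
    by (simp only: integral_mult_right_zero)
  also have "(LINT p|lborel. (\<Sum>i\<le>n. (-1) ^ i * (Q p * D i b p * ((b - \<phi> p) ^ i / fact i)))) =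
      (\<Sum>i\<le>n. (-1) ^ i * (LINT p|lborel. Q p * D i b p * ((b - \<phi> p) ^ i / fact i)))"
    by (subst Bochner_Integration.integral_sum)
       (simp_all only: integrable_mult_right term_int integral_mult_right_zero atMost_iff)
  also have "\<dots> = (\<Sum>i\<le>n. (-1) ^ i * (LINT p|lborel. Q p * D i b p * trunc_pow i b (\<phi> p)))"
    by (simp only: trunc)
  also have "(LINT p|lborel. Q p * (LINT s|lborel. indicator {a..b} s * ?H s p)) =
      (LINT s|lborel. indicator {a..b} s * (LINT p|lborel. Q p * D (Suc n) s p * trunc_pow n s (\<phi> p)))"
    unfolding swap(2)
  proof (intro Bochner_Integration.integral_cong refl)
    fix s
    show "indicator {a..b} s * (LINT p|lborel. Q p * ?H s p) =
      indicator {a..b} s * (LINT p|lborel. Q p * D (Suc n) s p * trunc_pow n s (\<phi> p))"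
    proof (cases "s \<in> {a..b}")
      case True
      have "(\<lambda>p. Q p * ?H s p) = (\<lambda>p. Q p * D (Suc n) s p * trunc_pow n s (\<phi> p))"
        using QK True by (auto simp: indicator_def fun_eq_iff)
      then show ?thesis by (simp only:)
    qed simp
  qed
  finally show ?thesis .
qed

section \<open>Partial derivatives and a Borel representative of the density\<close>

lemma partial_deriv_has_derivative_y:
  assumes "partial_deriv_exists I J f (Suc i) j" "y \<in> I" "z \<in> J"
  shows "((\<lambda>u. partial_deriv I J f i j (u, z)) has_vector_derivative
    partial_deriv I J f (Suc i) j (y, z)) (at y within I)"
proof -
  have "(\<lambda>u. partial_deriv I J f i j (u, z)) differentiable (at y within I)"
    using assms by (simp add: partial_deriv_exists_def)
  then show ?thesis
    by (simp add: vector_derivative_works partial_deriv_def d_y_def)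
qed

text \<open>Since \<open>partial_deriv\<close> differentiates in z first, its definition gives
  z-derivatives directly only at \<open>i = 0\<close>. This dictates the order of the expansions:
  first in z, then in y.\<close>

lemma partial_deriv_has_derivative_z:
  assumes "partial_deriv_exists I J f 0 (Suc j)" "y \<in> I" "z \<in> J"
  shows "((\<lambda>v. partial_deriv I J f 0 j (y, v)) has_vector_derivative
    partial_deriv I J f 0 (Suc j) (y, z)) (at z within J)"
proof -
  have "(\<lambda>v. partial_deriv I J f 0 j (y, v)) differentiable (at z within J)"
    using assms by (simp add: partial_deriv_exists_def)
  then show ?thesis
    by (simp add: vector_derivative_works partial_deriv_def d_z_def)
qed

text \<open>Absolute integrability makes the cut-off \<open>P\<close> only Lebesgue measurable,
  while Fubini is applied to products of \<open>lborel\<close>. A Lebesgue measurable function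
  agrees almost everywhere with a Borel one.\<close>

lemma absolutely_integrable_borel_version:
  fixes P :: "'a::euclidean_space \<Rightarrow> real"
  assumes "P absolutely_integrable_on K" and K [measurable]: "K \<in> sets borel"
  obtains Q where "integrable lborel Q" "\<And>p. p \<notin> K \<Longrightarrow> Q p = 0"
    "AE p in lborel. indicator K p * P p = Q p"
proof -
  have int: "integrable lebesgue (\<lambda>p. indicator K p * P p)"
    using assms(1) by (simp add: set_integrable_def)
  then obtain Q0 where Q0 [measurable]: "Q0 \<in> borel_measurable lborel"
    and ae: "AE p in lborel. indicator K p * P p = Q0 p"
    using completion_ex_borel_measurable_real[of "\<lambda>p. indicator K p * P p" lborel] by blast
  \<comment> \<open>The extra indicator makes \<open>Q\<close> vanish at every point off
    \<open>K\<close>, not just at almost every one.\<close>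
  define Q where "Q = (\<lambda>p. indicator K p * Q0 p)"
  have Q_meas: "Q \<in> borel_measurable lborel"
    unfolding Q_def by measurable
  have ae': "AE p in lborel. indicator K p * P p = Q p"
    using ae by eventually_elim (auto simp: Q_def indicator_def)
  show thesis
  proof (rule that)
    have "integrable lebesgue Q"
      using int Q_meas AE_completion[OF ae']
      by (subst (asm) integrable_cong_AE) (auto intro: measurable_completion borel_measurable_integrable[OF int])
    then show "integrable lborel Q"
      using Q_meas by (simp add: integrable_completion)
  qed (use ae' in \<open>auto simp: Q_def\<close>)
qed

section \<open>Double expansion of the functional and the sign of the remainder\<close>

theorem theorem4p6:
  fixes a b c d :: real and M N :: nat and P :: "real \<times> real \<Rightarrow> real"
  assumes "a < b" and "c < d"
    and "P absolutely_integrable_on ({a..b} \<times> {c..d})"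
    and "\<forall>i\<in>{0..M}. \<forall>j\<in>{0..N}.
      integral {a..b} (\<lambda>y. integral {c..d} (\<lambda>z.
        P (y, z) * ((b - y) ^ i / fact i) * ((d - z) ^ j / fact j))) = 0"
    and "\<forall>j\<in>{0..N}. \<forall>s\<in>{a..b}.
      integral {a..s} (\<lambda>y. integral {c..d} (\<lambda>z.
        P (y, z) * ((s - y) ^ M / fact M) * ((d - z) ^ j / fact j))) = 0"
    and "\<forall>i\<in>{0..M}. \<forall>t\<in>{c..d}.
      integral {a..b} (\<lambda>y. integral {c..t} (\<lambda>z.
        P (y, z) * ((b - y) ^ i / fact i) * ((t - z) ^ N / fact N))) = 0"
    and "\<forall>s\<in>{a..b}. \<forall>t\<in>{c..d}.
      integral {a..s} (\<lambda>y. integral {c..t} (\<lambda>z.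
        P (y, z) * ((s - y) ^ M / fact M) * ((t - z) ^ N / fact N))) \<ge> 0"
  shows "\<forall>f :: real \<times> real \<Rightarrow> real.
    continuous_partial_derivs {a..b} {c..d} (M + 1) (N + 1) f \<and>
    completely_monotonic {a..b} {c..d} (M + 1) (N + 1) f \<longrightarrow>
    integral {a..b} (\<lambda>y. integral {c..d} (\<lambda>z. P (y, z) * f (y, z))) \<ge> 0"
proof (intro allI impI, elim conjE)
  fix f :: "real \<times> real \<Rightarrow> real"
  assume C: "continuous_partial_derivs {a..b} {c..d} (M + 1) (N + 1) f"
    and CM: "completely_monotonic {a..b} {c..d} (M + 1) (N + 1) f"
  let ?K = "{a..b} \<times> {c..d}"
  define F where "F = partial_deriv {a..b} {c..d} f"
  have K: "compact ?K" by (intro compact_Times compact_Icc)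
  have [measurable]: "?K \<in> sets borel" using K by (rule borel_compact)
  obtain Q where Q: "integrable lborel Q" and Q0: "\<And>p. p \<notin> ?K \<Longrightarrow> Q p = 0"
    and QP: "AE p in lborel. indicator ?K p * P p = Q p"
    using absolutely_integrable_borel_version[OF assms(3)] by auto
  have [measurable]: "Q \<in> borel_measurable borel" using Q by (simp add: integrable_iff_bounded)
  \<comment> \<open>These are the moments of \<open>P\<close> against products of truncated powers.
    For \<open>i \<le> M\<close>, \<open>j \<le> N\<close> and \<open>s\<close>, \<open>t\<close> in
    their intervals, the four hypotheses become \<open>\<mu> i b j d = 0\<close>,
    \<open>\<mu> M s j d = 0\<close>, \<open>\<mu> i b N t = 0\<close> and
    \<open>\<mu> M s N t \<ge> 0\<close>.\<close>
  define \<mu> where "\<mu> i s j t = (LINT p|lborel. Q p * (trunc_pow i s (fst p) * trunc_pow j t (snd p)))"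
    for i s j t

  have exists: "partial_deriv_exists {a..b} {c..d} f i j" if "i \<le> Suc M" "j \<le> Suc N" for i j
    using C that by (simp add: continuous_partial_derivs_def)
  have F_cont: "continuous_on ?K (F i j)" if "i \<le> Suc M" "j \<le> Suc N" for i j
    using C that by (simp add: continuous_partial_derivs_def F_def)

  \<comment> \<open>The domain \<open>A \<times> B\<close> may be a smaller rectangle: the weight
    \<open>w\<close> then carries the cutoff, so that everything becomes an integral against the one
    density \<open>Q\<close>.\<close>
  have functional_eq: "integral A (\<lambda>y. integral B (\<lambda>z. G y z)) = (LINT p|lborel. Q p * w p)"
    if w: "w \<in> borel_measurable borel" and bd: "\<And>p. p \<in> ?K \<Longrightarrow> \<bar>w p\<bar> \<le> E"
      and eq: "\<And>y z. indicator (A \<times> B) (y, z) * G y z = indicator ?K (y, z) * P (y, z) * w (y, z)"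
    for A B G w E
  proof -
    have "integrable lborel (\<lambda>p. Q p * w p)"
      using w bd Q0 by (intro integrable_mult_bounded[OF Q, where B = E]) auto
    moreover have "AE p in lborel. indicator (A \<times> B) p * (case p of (y, z) \<Rightarrow> G y z) = Q p * w p"
      using QP by eventually_elim (use eq in force)
    ultimately show ?thesis
      using iterated_integral_eq_lborel[of "\<lambda>p. Q p * w p" A B "\<lambda>(y, z). G y z"] by simp
  qed

  have \<mu>_eq: "integral {a..s} (\<lambda>y. integral {c..t} (\<lambda>z.
      P (y, z) * ((s - y) ^ i / fact i) * ((t - z) ^ j / fact j))) = \<mu> i s j t"
    if "s \<in> {a..b}" "t \<in> {c..d}" for i j s t
    unfolding \<mu>_def
  proof (rule functional_eq)
    show "\<bar>trunc_pow i s (fst p) * trunc_pow j t (snd p)\<bar> \<le>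
        (b - a) ^ i / fact i * ((d - c) ^ j / fact j)" if "p \<in> ?K" for p
    proof -
      have "trunc_pow i s (fst p) * trunc_pow j t (snd p) \<le>
          (b - a) ^ i / fact i * ((d - c) ^ j / fact j)"
        using that \<open>s \<in> _\<close> \<open>t \<in> _\<close> \<open>a < b\<close>
        by (intro mult_mono trunc_pow_le trunc_pow_nonneg) auto
      then show ?thesis by (simp add: trunc_pow_nonneg)
    qed
  qed (use that in \<open>auto simp: trunc_pow_def indicator_def borel_prod[symmetric]\<close>)

  \<comment> \<open>This is the Taylor expansion in y with density
    \<open>Q p * trunc_pow l t (snd p)\<close> and the z-argument of \<open>F\<close> frozen at
    \<open>t\<close>. The index \<open>l\<close> is separate from \<open>j\<close> because the
    boundary terms in z use \<open>l = j\<close>, whereas the remainder uses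
    \<open>j = Suc N\<close> with \<open>l = N\<close>.\<close>
  have expand_y: "(LINT p|lborel. Q p * F 0 j (fst p, t) * trunc_pow l t (snd p)) =
      (\<Sum>i\<le>M. (-1) ^ i * (F i j (b, t) * \<mu> i b l t)) +
      (-1) ^ Suc M * (LINT s|lborel. indicator {a..b} s * (F (Suc M) j (s, t) * \<mu> M s l t))"
    if j: "j \<le> Suc N" and t: "t \<in> {c..d}" for j l t
  proof -
    have Q': "integrable lborel (\<lambda>p. Q p * trunc_pow l t (snd p))"
    proof (rule integrable_mult_bounded[OF Q])
      show "(\<lambda>p. trunc_pow l t (snd p)) \<in> borel_measurable (lborel :: (real \<times> real) measure)"
        by (simp add: borel_prod[symmetric])
      show "\<bar>trunc_pow l t (snd p)\<bar> \<le> (d - c) ^ l / fact l" if "Q p \<noteq> 0" for p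
      proof -
        have "p \<in> ?K" using Q0 that by blast
        then show ?thesis using t by (auto simp: trunc_pow_nonneg intro!: trunc_pow_le)
      qed
    qed
    have "(LINT p|lborel. Q p * trunc_pow l t (snd p) * F 0 j (fst p, t)) =
      (\<Sum>i\<le>M. (-1) ^ i * (LINT p|lborel. Q p * trunc_pow l t (snd p) * F i j (b, t) *
        trunc_pow i b (fst p))) +
      (-1) ^ Suc M * (LINT s|lborel. indicator {a..b} s *
        (LINT p|lborel. Q p * trunc_pow l t (snd p) * F (Suc M) j (s, t) * trunc_pow M s (fst p)))"
    proof (rule functional_taylor[OF Q' K, where D = "\<lambda>i s p. F i j (s, t)"])
      show "((\<lambda>s. F i j (s, t)) has_vector_derivative F (Suc i) j (s, t)) (at s within {a..b})"
        if "i \<le> M" "s \<in> {a..b}" for i s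
        unfolding F_def using that j t by (intro partial_deriv_has_derivative_y exists) auto
      show "continuous_on ({a..b} \<times> ?K) (\<lambda>(s, p). F i j (s, t))" if "i \<le> Suc M" for i
        unfolding case_prod_beta'
        by (rule continuous_on_compose2[OF F_cont[OF that j]]) (use t in \<open>auto intro!: continuous_intros\<close>)
    qed (use Q0 in \<open>auto intro!: continuous_intros\<close>)
    moreover have "(LINT p|lborel. Q p * trunc_pow l t (snd p) * x * trunc_pow i s (fst p)) =
        x * \<mu> i s l t" for x i s
      unfolding \<mu>_def integral_mult_right_zero[symmetric] by (simp only: ac_simps)
    moreover have "(LINT p|lborel. Q p * F 0 j (fst p, t) * trunc_pow l t (snd p)) =
        (LINT p|lborel. Q p * trunc_pow l t (snd p) * F 0 j (fst p, t))"
      by (simp only: ac_simps)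
    ultimately show ?thesis by (simp only:)
  qed

  have "integral {a..b} (\<lambda>y. integral {c..d} (\<lambda>z. P (y, z) * f (y, z))) =
      (LINT p|lborel. Q p * (indicator ?K p * f p))"
  proof -
    have c: "continuous_on ?K f"
      using F_cont[of 0 0] by (simp add: F_def partial_deriv_def)
    obtain E where "\<And>p. p \<in> ?K \<Longrightarrow> \<bar>f p\<bar> \<le> E"
      using bounded_on_compact[OF K c] by blast
    then show ?thesis
      using borel_measurable_continuous_on_indicator[OF _ c]
      by (intro functional_eq[where E = E]) (auto simp: indicator_def)
  qed
  also have "\<dots> = (LINT p|lborel. Q p * F 0 0 (fst p, snd p))"
    using Q0 by (intro Bochner_Integration.integral_cong)
      (auto simp: F_def partial_deriv_def indicator_def)
  also have "\<dots> = (\<Sum>j\<le>N. (-1) ^ j * (LINT p|lborel. Q p * F 0 j (fst p, d) * trunc_pow j d (snd p))) +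
      (-1) ^ Suc N * (LINT t|lborel. indicator {c..d} t *
        (LINT p|lborel. Q p * F 0 (Suc N) (fst p, t) * trunc_pow N t (snd p)))"
  proof (rule functional_taylor[OF Q K, where D = "\<lambda>j t p. F 0 j (fst p, t)"])
    show "((\<lambda>t. F 0 j (fst p, t)) has_vector_derivative F 0 (Suc j) (fst p, t)) (at t within {c..d})"
      if "j \<le> N" "t \<in> {c..d}" "p \<in> ?K" for j t p
      unfolding F_def using that by (intro partial_deriv_has_derivative_z exists) auto
    show "continuous_on ({c..d} \<times> ?K) (\<lambda>(t, p). F 0 j (fst p, t))" if "j \<le> Suc N" for j
      unfolding case_prod_beta'
      by (rule continuous_on_compose2[OF F_cont[OF _ that]]) (auto intro!: continuous_intros)
  qed (use Q0 in \<open>auto intro!: continuous_intros\<close>)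
  \<comment> \<open>Expand each boundary coefficient in y with \<open>l = j\<close> and
    \<open>t = d\<close>: the first hypothesis kills the terms at \<open>b\<close>, the second kills
    the remainder integrand for every \<open>s\<close>.\<close>
  also have "(\<Sum>j\<le>N. (-1) ^ j * (LINT p|lborel. Q p * F 0 j (fst p, d) * trunc_pow j d (snd p))) = 0"
  proof (intro sum.neutral ballI)
    fix j assume "j \<in> {..N}"
    then have j: "j \<le> N" by simp
    have "\<mu> i b j d = 0" if "i \<le> M" for i
      using assms(1,2,4) that j \<mu>_eq[of b d i j] by simp
    moreover have "(\<lambda>s. indicator {a..b} s * (F (Suc M) j (s, d) * \<mu> M s j d)) = (\<lambda>s. 0)"
      using assms(1,2,5) j \<mu>_eq[of _ d M j] by (auto simp: fun_eq_iff indicator_def)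
    ultimately show "(-1) ^ j * (LINT p|lborel. Q p * F 0 j (fst p, d) * trunc_pow j d (snd p)) = 0"
      using expand_y[of j d j] assms(2) j by (simp del: mult_eq_0_iff)
  qed
  \<comment> \<open>The sign is moved inside the integral over \<open>t\<close>, so that
    nonnegativity can be checked for each \<open>t\<close> separately.\<close>
  finally have repr: "integral {a..b} (\<lambda>y. integral {c..d} (\<lambda>z. P (y, z) * f (y, z))) =
      (LINT t|lborel. indicator {c..d} t *
        ((-1) ^ Suc N * (LINT p|lborel. Q p * F 0 (Suc N) (fst p, t) * trunc_pow N t (snd p))))"
    by (simp only: add_0 mult.left_commute flip: integral_mult_right_zero)
  have "0 \<le> (-1) ^ Suc N * (LINT p|lborel. Q p * F 0 (Suc N) (fst p, t) * trunc_pow N t (snd p))"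
    if t: "t \<in> {c..d}" for t
  proof -
    \<comment> \<open>By the third hypothesis only the y-remainder survives. Its sign combines with
      the one from z to \<open>(-1) ^ (Suc M + Suc N)\<close>, which makes the top derivative
      nonnegative by complete monotonicity; the other factor is nonnegative by the fourth
      hypothesis.\<close>
    have "\<mu> i b N t = 0" if "i \<le> M" for i
      using assms(1,6) that t \<mu>_eq[of b t i N] by simp
    then have "(-1) ^ Suc N * (LINT p|lborel. Q p * F 0 (Suc N) (fst p, t) * trunc_pow N t (snd p)) =
        (-1) ^ (Suc M + Suc N) * (LINT s|lborel. indicator {a..b} s * (F (Suc M) (Suc N) (s, t) * \<mu> M s N t))"
      using expand_y[of "Suc N" t N] t by (simp add: power_add)
    also have "\<dots> = (LINT s|lborel. indicator {a..b} s *
        ((-1) ^ (Suc M + Suc N) * F (Suc M) (Suc N) (s, t) * \<mu> M s N t))"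
      by (simp only: ac_simps flip: integral_mult_right_zero)
    also have "\<dots> \<ge> 0"
    proof (intro Bochner_Integration.integral_nonneg)
      fix s
      show "0 \<le> indicator {a..b} s * ((-1) ^ (Suc M + Suc N) * F (Suc M) (Suc N) (s, t) * \<mu> M s N t)"
      proof (cases "s \<in> {a..b}")
        case True
        have "0 \<le> (-1) ^ (Suc M + Suc N) * F (Suc M) (Suc N) (s, t)"
          using CM True t unfolding completely_monotonic_def F_def Suc_eq_plus1
          by (meson atLeastAtMost_iff le0 order_refl)
        moreover have "0 \<le> \<mu> M s N t"
          unfolding \<mu>_eq[OF True t, symmetric] using assms(7) True t by blast
        ultimately have "0 \<le> (-1) ^ (Suc M + Suc N) * F (Suc M) (Suc N) (s, t) * \<mu> M s N t"
          by (rule mult_nonneg_nonneg)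
        then show ?thesis
          by (rule mult_nonneg_nonneg[OF indicator_pos_le])
      qed simp
    qed
    finally show ?thesis .
  qed
  then show "0 \<le> integral {a..b} (\<lambda>y. integral {c..d} (\<lambda>z. P (y, z) * f (y, z)))"
    unfolding repr by (intro Bochner_Integration.integral_nonneg) (auto simp: indicator_def)
qed

end
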